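(* For every integer $r\ge 3$, if $P_r$ denotes the regular $r$-gon, then $N_{P_r}=T(r,2)-2=3r-4$. That is, $3r-4$ is the minimum $N$ such that almost any $N$ points in $\mathbb{R}^2$ admit a $P_r$-partition.
   Context: $T(r,d):=(r-1)(d+1)+1$. A $P_r$-partition of a finite set $S\subset\mathbb{R}^2$ is a partition of $S$ into $r$ pairwise disjoint sets $A_1,\dots,A_r$ for which there exist points $x_1\in\mathrm{Conv}(A_1),\dots,x_r\in\mathrm{Conv}(A_r)$ that are the vertices (in some order) of a (non-degenerate) regular $r$-gon of any size, position and orientation. $N_{P_r}$ is the minimum $N$ such that almost any $N$ points in $\mathbb{R}^2$ (i.e., Lebesgue-almost every $N$-tuple in $(\mathbb{R}^2)^N$) admit a $P_r$-partition. *)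

theory Defs
  imports "HOL-Analysis.Analysis"
begin

definition tverberg_number :: "nat \<Rightarrow> nat \<Rightarrow> nat" where
  "tverberg_number r d = (r - 1) * (d + 1) + 1"

(* V is the vertex set of a non-degenerate regular r-gon with centre c, circumradius \<rho> and
   orientation \<theta>; meaningful for r \<ge> 3. *)
definition regular_polygon_vertices :: "nat \<Rightarrow> (real^2) set \<Rightarrow> bool" where
  "regular_polygon_vertices r V \<longleftrightarrow>
     (\<exists>(c :: real^2) (\<rho> :: real) (\<theta> :: real). \<rho> > 0 \<and>
        V = (\<lambda>k. c + \<rho> *\<^sub>R vector [cos (\<theta> + 2 * pi * real k / real r),
                                sin (\<theta> + 2 * pi * real k / real r)]) ` {..<r})"

(* P is the unordered family of parts. The chosen points f A, for A in P, run through the vertices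
   of the polygon without repetition; no cyclic order is imposed. *)
definition polygon_partition :: "nat \<Rightarrow> (real^2) set \<Rightarrow> (real^2) set set \<Rightarrow> bool" where
  "polygon_partition r S P \<longleftrightarrow>
     partition_on S P \<and> card P = r \<and>
     (\<exists>f V. (\<forall>A\<in>P. f A \<in> convex hull A) \<and> regular_polygon_vertices r V \<and> bij_betw f P V)"

(* N-tuples of points of the plane are functions on {..<N}, and the product measure is Lebesgue
   measure on their space. Tuples with repeated entries form a null set. *)
definition almost_any_points_admit_polygon_partition :: "nat \<Rightarrow> nat \<Rightarrow> bool" where
  "almost_any_points_admit_polygon_partition r N \<longleftrightarrow>
     (AE x in (\<Pi>\<^sub>M i\<in>{..<N}. (lborel :: (real^2) measure)).
        \<exists>P. polygon_partition r (x ` {..<N}) P)"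

definition polygon_number :: "nat \<Rightarrow> nat" where
  "polygon_number r = (LEAST N. almost_any_points_admit_polygon_partition r N)"

end

theory Submission imports Defs begin

text \<open>
  Regular polygons with labelled vertices \<open>c + z \<omega>\<^sup>k\<close> form a linear family with four real parameters.
  A partition of \<open>N\<close> generic points into \<open>r\<close> parts imposes at least \<open>3 r - N\<close> independent conditions on
  these parameters (a point two, a pair of points one), so almost surely no partition exists
  if \<open>3 r - N > 4\<close>. For the same reason, if \<open>3 r - N = 4\<close>, almost surely no part-wise choice of points
  collapses to a single point \<open>c\<close>.

  For \<open>3 r - N = 4\<close>, colourful Caratheodory in dimension \<open>3 r - 5\<close> assigns the \<open>N\<close> points
  to \<open>r\<close> parts and gives them weights such that all parts have equal weight and the centroids of the parts are
  \<open>c + z \<omega>\<^sup>k\<close>; almost surely \<open>z \<noteq> 0\<close>.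
\<close>

section \<open>Generic incidences\<close>

text \<open>Tube lemma: projection along a compact factor is a closed map. The factor
  \<open>'b\<close> is an arbitrary topological space because it will be a function space with the
  product topology.\<close>

lemma closed_projection_compact:
  fixes S :: "'a::topological_space set" and T :: "('a \<times> 'b::topological_space) set"
  assumes "compact S" "closed T"
  shows "closed {y. \<exists>x\<in>S. (x, y) \<in> T}"
proof -
  have "compact_space (top_of_set S)"
    using assms(1) by (simp add: compact_space_subtopology)
  then have *: "closed_map (prod_topology (top_of_set S) (euclidean :: 'b topology)) euclidean snd"
    by (rule Abstract_Topological_Spaces.closed_map_snd)
  have "prod_topology (top_of_set S) (euclidean :: 'b topology) = top_of_set (S \<times> UNIV)"
    by (simp add: prod_topology_subtopology)
  with * have "closed_map (top_of_set (S \<times> UNIV)) (euclidean :: 'b topology) snd" by simp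
  moreover have "closedin (top_of_set (S \<times> UNIV)) ((S \<times> UNIV) \<inter> T)"
    using assms(2) by (rule closedin_closed_Int)
  ultimately have "closed (snd ` ((S \<times> UNIV) \<inter> T))"
    unfolding closed_map_def closed_closedin by blast
  also have "snd ` ((S \<times> UNIV) \<inter> T) = {y. \<exists>x\<in>S. (x, y) \<in> T}"
    by force
  finally show ?thesis .
qed

definition det2 :: "real^2 \<Rightarrow> real^2 \<Rightarrow> real" where
  "det2 a b = a $ 1 * b $ 2 - a $ 2 * b $ 1"

text \<open>The determinant makes collinearity a closed condition even where \<^term>\<open>x i = x j\<close>.\<close>
definition incident :: "'i \<Rightarrow> 'i \<Rightarrow> ('i \<Rightarrow> real^2) \<Rightarrow> real^2 \<Rightarrow> bool" where
  "incident i j x q \<longleftrightarrow> (if i = j then q = x i else det2 (x i - x j) (x i - q) = 0)"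

lemma closed_incident:
  fixes f :: "'e::topological_space \<Rightarrow> real^2"
  assumes "continuous_on UNIV f"
  shows "closed {(v, x). incident i j x (f v)}"
proof -
  have f: "continuous_on UNIV (\<lambda>z :: 'e \<times> ('i \<Rightarrow> real^2). f (fst z))"
    by (rule continuous_on_compose2[OF assms]) (auto intro: continuous_intros)
  have p: "continuous_on UNIV (\<lambda>z :: 'e \<times> ('i \<Rightarrow> real^2). snd z i)" for i
    by (rule continuous_on_product_then_coordinatewise) (intro continuous_intros)
  show ?thesis
    unfolding incident_def det2_def case_prod_unfold
    by (cases "i = j") (auto intro!: closed_Collect_eq continuous_intros f p)
qed

text \<open>The set is a countable union of projections of closed sets along compact ones.\<close>
lemma borel_ex_incident:
  fixes L :: "'k \<Rightarrow> 'e::euclidean_space \<Rightarrow> real^2"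
  assumes "\<And>k. k \<in> K \<Longrightarrow> linear (L k)" "subspace V"
  shows "{x. \<exists>v\<in>V. \<forall>k\<in>K. incident (i k) (j k) x (L k (p + v))} \<in> sets borel"
proof -
  let ?T = "\<Inter>k\<in>K. {(v, x). incident (i k) (j k) x (L k (p + v))}"
  have "closed ?T"
  proof (intro closed_INT ballI closed_incident)
    fix k assume "k \<in> K"
    show "continuous_on UNIV (\<lambda>v. L k (p + v))"
      by (rule continuous_on_compose2[OF linear_continuous_on[OF linear_conv_bounded_linear[THEN iffD1, OF assms(1)[OF \<open>k \<in> K\<close>]]]])
        (auto intro: continuous_intros)
  qed
  moreover have "compact (V \<inter> cball 0 (real n))" for n
    using closed_subspace[OF assms(2)] by (simp add: closed_Int_compact)
  ultimately have "closed {x. \<exists>v\<in>V \<inter> cball 0 (real n). (v, x) \<in> ?T}" for n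
    by (rule closed_projection_compact[rotated])
  then have "(\<Union>n. {x. \<exists>v\<in>V \<inter> cball 0 (real n). (v, x) \<in> ?T}) \<in> sets borel"
    by (intro sets.countable_UN) auto
  also have "(\<Union>n. {x. \<exists>v\<in>V \<inter> cball 0 (real n). (v, x) \<in> ?T}) =
      {x. \<exists>v\<in>V. \<forall>k\<in>K. incident (i k) (j k) x (L k (p + v))}"
  proof (intro set_eqI iffI)
    fix x assume "x \<in> {x. \<exists>v\<in>V. \<forall>k\<in>K. incident (i k) (j k) x (L k (p + v))}"
    then obtain v where v: "v \<in> V" "\<forall>k\<in>K. incident (i k) (j k) x (L k (p + v))" by blast
    obtain n where "norm v \<le> real n" using real_arch_simple by blast
    then have "v \<in> V \<inter> cball 0 (real n)" using v(1) by simp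
    with v(2) show "x \<in> (\<Union>n. {x. \<exists>v\<in>V \<inter> cball 0 (real n). (v, x) \<in> ?T})" by blast
  qed auto
  finally show ?thesis .
qed

text \<open>Lets Borel sets of the full function space serve as events for the product measure over
  \<open>I\<close>, whose points are \<open>undefined\<close> off \<open>I\<close>. Since
  \<open>'i\<close> is countable, measurability can be checked coordinate by coordinate.\<close>

lemma measurable_ident_PiM_borel:
  "(\<lambda>x. x) \<in> measurable (Pi\<^sub>M I (\<lambda>_. lborel)) (borel :: ('i::countable \<Rightarrow> 'a::euclidean_space) measure)"
proof (rule measurable_coordinatewise_then_product)
  fix i
  show "(\<lambda>x. x i) \<in> borel_measurable (Pi\<^sub>M I (\<lambda>_. lborel :: 'a measure))"
  proof (cases "i \<in> I")
    case True
    then show ?thesis by measurable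
  next
    case False
    then have "x i = undefined" if "x \<in> space (Pi\<^sub>M I (\<lambda>_. lborel :: 'a measure))" for x
      using that by (auto simp: space_PiM PiE_def extensional_def)
    then show ?thesis
      by (subst measurable_cong[where g = "\<lambda>_. undefined"]) auto
  qed
qed

text \<open>Tonelli with the new coordinate outermost, so that an argument may fix the point with
  index \<open>a\<close> first. The exceptional set is Borel, hence its measure is an iterated
  integral, which vanishes.\<close>

lemma AE_PiM_insert:
  fixes P :: "('i::countable \<Rightarrow> 'a::euclidean_space) \<Rightarrow> bool"
  assumes "finite I" "a \<notin> I" and P: "{x. \<not> P x} \<in> sets borel"
    and AE: "AE y in lborel. AE x in Pi\<^sub>M I (\<lambda>_. lborel). P (x(a := y))"
  shows "AE x in Pi\<^sub>M (insert a I) (\<lambda>_. lborel). P x"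
proof -
  interpret product_sigma_finite "\<lambda>_ :: 'i. lborel :: 'a measure" ..
  let ?M = "\<lambda>J. Pi\<^sub>M J (\<lambda>_. lborel :: 'a measure)"
  have m: "{x \<in> space (?M J). \<not> P (f x)} \<in> sets (?M J)"
    if "f \<in> borel_measurable (?M J)" for J f
    using measurable_sets[OF that P] by (simp add: vimage_def Int_def conj_commute)
  have upd: "(\<lambda>x. x(a := y)) \<in> borel_measurable (?M I)" for y
  proof (rule measurable_coordinatewise_then_product)
    fix i show "(\<lambda>x. (x(a := y)) i) \<in> borel_measurable (?M I)"
      using measurable_compose[OF measurable_ident_PiM_borel borel_measurable_continuous_onI[OF continuous_on_product_coordinates]]
      by (cases "i = a") auto
  qed
  let ?f = "indicator {x. \<not> P x} :: _ \<Rightarrow> ennreal"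
  have f: "?f \<in> borel_measurable (?M (insert a I))"
    using measurable_compose[OF measurable_ident_PiM_borel borel_measurable_indicator[OF P]] .
  have g: "(\<integral>\<^sup>+ x. ?f (x(a := y)) \<partial>?M I) = 0" if "AE x in ?M I. P (x(a := y))" for y
    using that by (subst nn_integral_0_iff_AE)
      (auto intro!: measurable_compose[OF upd borel_measurable_indicator[OF P]])
  have "integral\<^sup>N (?M (insert a I)) ?f = (\<integral>\<^sup>+ y. (\<integral>\<^sup>+ x. ?f (x(a := y)) \<partial>?M I) \<partial>lborel)"
    by (rule product_nn_integral_insert_rev[OF assms(1,2) f])
  also have "\<dots> = (\<integral>\<^sup>+ y. 0 \<partial>(lborel :: 'a measure))"
    using AE by (intro nn_integral_cong_AE) (auto intro: g)
  finally have "AE x in ?M (insert a I). ?f x = 0"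
    using f by (simp add: nn_integral_0_iff_AE)
  then show ?thesis
    by eventually_elim (auto simp: indicator_def split: if_splits)
qed

text \<open>Closedness makes the Lebesgue null set a Borel null set; \<open>lborel\<close> itself is
  not complete.\<close>

lemma negligible_imp_AE_lborel:
  assumes "negligible S" "closed S"
  shows "AE y in lborel. y \<notin> S"
proof (rule AE_not_in)
  have "S \<in> sets lborel" using assms(2) by simp
  then show "S \<in> null_sets lborel"
    using assms(1) by (simp add: negligible_iff_null_sets null_sets_completion_iff)
qed


section \<open>Dimension drops and null sets in linear families\<close>

lemma subspace_kernel_Int:
  assumes "subspace V" "linear g"
  shows "subspace {v \<in> V. g v = 0}"
  using subspace_inter[OF assms(1) linear_subspace_kernel[OF assms(2)]] by (simp add: Int_def)

lemma dim_kernel_less: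
  fixes V :: "'e::euclidean_space set" and g :: "'e \<Rightarrow> 'b::real_vector"
  assumes "subspace V" "linear g" "v \<in> V" "g v \<noteq> 0"
  shows "dim {v \<in> V. g v = 0} < dim V"
proof (rule dim_psubset)
  have "subspace {v \<in> V. g v = 0}"
    using assms(1,2) by (rule subspace_kernel_Int)
  then show "span {v \<in> V. g v = 0} \<subset> span V"
    using assms by (auto simp: span_eq_iff[THEN iffD2])
qed

text \<open>The two coordinates of \<open>f\<close> are set to zero one after the other; the
  preimages \<open>v1\<close> and \<open>v2\<close> of the unit vectors show that each cut lowers
  the dimension.\<close>

lemma dim_kernel_surj2:
  fixes V :: "'e::euclidean_space set" and f :: "'e \<Rightarrow> real^2"
  assumes V: "subspace V" and f: "linear f" and "f ` V = UNIV"
  shows "dim {v \<in> V. f v = 0} + 2 \<le> dim V"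
proof -
  have lin: "linear (\<lambda>v. f v $ m)" for m
    using f by (simp add: linear_iff)
  obtain v1 v2 where v: "v1 \<in> V" "v2 \<in> V" "f v1 = vector [1, 0]" "f v2 = vector [0, 1]"
    using assms(3) by (metis UNIV_I imageE)
  let ?W = "{v \<in> V. f v $ 1 = 0}"
  have eq: "{v \<in> V. f v = 0} = {v \<in> ?W. f v $ 2 = 0}"
    by (auto simp: vec_eq_iff forall_2)
  have "dim {v \<in> V. f v = 0} < dim ?W"
    unfolding eq by (rule dim_kernel_less[of _ _ v2]) (use v in \<open>simp_all add: subspace_kernel_Int V lin\<close>)
  moreover have "dim ?W < dim V"
    by (rule dim_kernel_less[of _ _ v1]) (use v in \<open>simp_all add: V lin\<close>)
  ultimately show ?thesis by linarith
qed

text \<open>A proper linear image has smaller dimension, so its translates are closed and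
  negligible.\<close>

lemma AE_not_in_affine_image:
  fixes V :: "'e::euclidean_space set" and f :: "'e \<Rightarrow> 'b::euclidean_space"
  assumes "subspace V" "linear f" "f ` V \<noteq> UNIV"
  shows "AE y in lborel. \<forall>v\<in>V. f (p + v) \<noteq> y"
proof -
  have s: "subspace (f ` V)" by (rule linear_subspace_image) fact+
  have "dim (f ` V) < DIM('b)"
    using s assms(3) dim_eq_full[of "f ` V"] dim_subset_UNIV[of "f ` V"]
    by (metis le_neq_implies_less span_eq_iff)
  then have "negligible ((+) (f p) ` (f ` V))"
    by (intro negligible_translation negligible_lowdim)
  moreover have "closed ((+) (f p) ` (f ` V))"
    by (intro closed_translation closed_subspace s)
  ultimately have "AE y in lborel. y \<notin> (+) (f p) ` (f ` V)"
    by (rule negligible_imp_AE_lborel)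
  then show ?thesis
    by eventually_elim (auto simp: linear_add[OF assms(2)])
qed

lemma AE_det2_nonzero:
  assumes "y \<noteq> q"
  shows "AE z in lborel. det2 (y - z) (y - q) \<noteq> 0"
proof -
  let ?w = "y - q"
  \<comment> \<open>A normal vector of the line through \<open>y\<close> and \<open>q\<close>; the
    determinant vanishes exactly for \<open>z\<close> on this line.\<close>
  let ?a = "vector [?w $ 2, - ?w $ 1] :: real^2"
  have "?a $ 1 \<noteq> 0 \<or> ?a $ 2 \<noteq> 0"
    using assms by (simp add: vec_eq_iff forall_2) argo
  then have "?a \<noteq> 0" by (auto simp del: vector_2)
  then have "AE z in lborel. z \<notin> {z. ?a \<bullet> z = ?w $ 2 * y $ 1 - ?w $ 1 * y $ 2}"
    by (intro negligible_imp_AE_lborel negligible_hyperplane closed_hyperplane) simp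
  then show ?thesis
    by eventually_elim (simp add: det2_def inner_vec_def sum_2 algebra_simps)
qed

lemma linear_det2: "linear (det2 a)"
  by (simp add: linear_iff det2_def algebra_simps)

lemma incident_fun_upd:
  assumes "a \<notin> {i, j}"
  shows "incident i j (x(a := y)) q = incident i j x q"
  using assms by (auto simp: incident_def)

text \<open>Fixing the points of one class at a time, the flat of admissible parameters either becomes empty
  or loses at least as many dimensions as the class imposes conditions.\<close>
theorem AE_no_incident:
  fixes L :: "'k \<Rightarrow> 'e::euclidean_space \<Rightarrow> real^2" and i j :: "'k \<Rightarrow> 'i::countable"
  assumes "finite K" "\<And>k. k \<in> K \<Longrightarrow> linear (L k)" "finite I" "i ` K \<union> j ` K \<subseteq> I"
    and "disjoint_family_on (\<lambda>k. {i k, j k}) K" "subspace V"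
    and "dim V < (\<Sum>k\<in>K. if i k = j k then 2 else 1)"
  shows "AE x in Pi\<^sub>M I (\<lambda>_. lborel). \<not> (\<exists>v\<in>V. \<forall>k\<in>K. incident (i k) (j k) x (L k (p + v)))"
  using assms
proof (induction K arbitrary: I V p rule: finite_induct)
  case (insert k K)
  let ?P = "\<lambda>V p x. \<not> (\<exists>v\<in>V. \<forall>k\<in>K. incident (i k) (j k) x (L k (p + v)))"
  let ?Q = "\<lambda>x. \<not> (\<exists>v\<in>V. \<forall>k\<in>insert k K. incident (i k) (j k) x (L k (p + v)))"
  let ?a = "i k" and ?b = "j k"
  have lin: "linear (L k)" using insert.prems(1) by simp
  have meas: "{x. \<not> ?Q x} \<in> sets borel"
    using borel_ex_incident[of "insert k K" L V i j p] insert.prems(1,5) by simp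
  have apart: "?a \<notin> {i k', j k'}" "?b \<notin> {i k', j k'}" if "k' \<in> K" for k'
    using insert.prems(4) that insert.hyps(2) unfolding disjoint_family_on_def by fastforce+
  have upd: "incident (i k') (j k') (x(?a := y)) q = incident (i k') (j k') x q"
      "incident (i k') (j k') (x(?b := y)) q = incident (i k') (j k') x q" if "k' \<in> K" for k' x y q
    using apart[OF that] by (simp_all add: incident_fun_upd)
  \<comment> \<open>The remaining classes avoid the points of class \<open>k\<close>, so the
    induction hypothesis applies to the smaller index set, with a new flat
    \<open>p' + V'\<close>.\<close>
  have IH: "AE x in Pi\<^sub>M (I - {?a, ?b}) (\<lambda>_. lborel). ?P V' p' x"
    if "subspace V'" "dim V' < (\<Sum>k\<in>K. if i k = j k then 2 else 1)" for V' p'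
  proof (rule insert.IH)
    show "i ` K \<union> j ` K \<subseteq> I - {?a, ?b}"
      using insert.prems(3) apart by blast
    show "disjoint_family_on (\<lambda>k. {i k, j k}) K"
      using insert.prems(4) by (rule disjoint_family_on_mono[rotated]) auto
  qed (use insert.prems that in auto)
  show ?case
  proof (cases "?a = ?b")
    case True
    let ?J = "I - {?a}"
    have I: "I = insert ?a ?J" using insert.prems(3) by auto
    have J: "I - {?a, ?b} = ?J" using True by auto
    have inc: "incident ?a ?b (x(?a := y)) q \<longleftrightarrow> q = y" for x y q
      using True by (simp add: incident_def)
    have "AE y in lborel. AE x in Pi\<^sub>M ?J (\<lambda>_. lborel). ?Q (x(?a := y))"
    proof -
      \<comment> \<open>Either the image of the flat is a null set, which a generic \<open>y\<close>
        misses, or the map is onto and prescribing its value costs two dimensions.\<close>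
      have "AE y in lborel. (\<forall>v\<in>V. L k (p + v) \<noteq> y) \<or> L k ` V = UNIV"
        using AE_not_in_affine_image[OF insert.prems(5) lin, of p]
        by (cases "L k ` V = UNIV") (auto elim: eventually_mono)
      then show ?thesis
      proof eventually_elim
        case (elim y)
        show ?case
        proof (cases "\<exists>v\<in>V. L k (p + v) = y")
          case False
          then show ?thesis by (intro AE_I2) (auto simp: incident_def True)
        next
          case ex: True
          then obtain v0 where v0: "v0 \<in> V" "L k (p + v0) = y" by blast
          let ?V = "{v \<in> V. L k v = 0}"
          have "dim ?V + 2 \<le> dim V"
            using elim ex dim_kernel_surj2[OF insert.prems(5) lin] by blast
          then have "dim ?V < (\<Sum>k\<in>K. if i k = j k then 2 else 1)"
            using insert.prems(6) insert.hyps True by simp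
          \<comment> \<open>The parameters with \<open>L k (p + v) = y\<close> form the flat through
            \<open>p + v0\<close> in the direction of the kernel.\<close>
          from IH[OF subspace_kernel_Int[OF insert.prems(5) lin] this, of "p + v0"]
          have "AE x in Pi\<^sub>M ?J (\<lambda>_. lborel). ?P ?V (p + v0) x"
            unfolding J .
          then show ?thesis
          proof eventually_elim
            case (elim x)
            show ?case
            proof
              assume "\<exists>v\<in>V. \<forall>k'\<in>insert k K. incident (i k') (j k') (x(?a := y)) (L k' (p + v))"
              then obtain v where v: "v \<in> V" "L k (p + v) = y"
                  "\<And>k'. k' \<in> K \<Longrightarrow> incident (i k') (j k') x (L k' (p + v))"
                by (auto simp: upd inc)
              have "v - v0 \<in> ?V"
                using v v0 insert.prems(5) by (auto simp: subspace_diff linear_diff[OF lin] linear_add[OF lin])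
              then show False
                using elim v(3) by (auto simp: algebra_simps)
            qed
          qed
        qed
      qed
    qed
    then have "AE x in Pi\<^sub>M (insert ?a ?J) (\<lambda>_. lborel). ?Q x"
      using insert.prems(2) by (intro AE_PiM_insert meas) auto
    then show ?thesis unfolding I[symmetric] .
  next
    case False
    let ?J = "I - {?a, ?b}"
    have I: "I = insert ?a (insert ?b ?J)" using insert.prems(3) by auto
    \<comment> \<open>The exceptional set stays Borel once \<open>y\<close> is fixed, so the second
      point of the pair can be fixed in the same way.\<close>
    have meas_upd: "(\<lambda>x. x(?a := y)) \<in> borel_measurable (borel :: ('i \<Rightarrow> real^2) measure)" for y
    proof (intro borel_measurable_continuous_onI continuous_on_coordinatewise_then_product)
      show "continuous_on UNIV (\<lambda>x. (x(?a := y)) l)" for l by (cases "l = ?a") simp_all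
    qed
    have meas': "{x. \<not> ?Q (x(?a := y))} \<in> sets borel" for y
      using measurable_sets[OF meas_upd meas] by (simp add: vimage_def)
    \<comment> \<open>It suffices that the line through \<open>y\<close> and \<open>z\<close> misses
      \<open>L k p\<close>. Incidence then prescribes a nonzero value of the linear form
      \<open>g\<close> below: either no \<open>v\<close> in \<open>V\<close> attains it, or
      \<open>g\<close> is nonzero on \<open>V\<close> and a dimension is lost.\<close>
    have "AE y in lborel. y \<notin> {L k p}"
      by (intro negligible_imp_AE_lborel) auto
    then have "AE y in lborel. AE x in Pi\<^sub>M (insert ?b ?J) (\<lambda>_. lborel). ?Q (x(?a := y))"
    proof eventually_elim
      case (elim y)
      then have "AE z in lborel. det2 (y - z) (y - L k p) \<noteq> 0"
        by (intro AE_det2_nonzero) simp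
      then have "AE z in lborel. AE x in Pi\<^sub>M ?J (\<lambda>_. lborel). ?Q (x(?b := z, ?a := y))"
      proof eventually_elim
        case (elim z)
        define g where "g v = det2 (y - z) (L k v)" for v
        have g: "linear g"
          unfolding g_def using linear_compose[OF lin linear_det2] by (simp add: o_def)
        have inc: "incident ?a ?b (x(?b := z, ?a := y)) (L k (p + v)) \<longleftrightarrow> g v = det2 (y - z) (y - L k p)" for v x
          using False linear_add[OF lin, of p v] linear_diff[OF linear_det2, of "y - z" "y - L k p" "L k v"]
          by (auto simp: incident_def g_def algebra_simps)
        show ?case
        proof (cases "\<exists>v\<in>V. g v = det2 (y - z) (y - L k p)")
          case False
          then show ?thesis by (intro AE_I2) (auto simp: inc)
        next
          case True
          then obtain v0 where v0: "v0 \<in> V" "g v0 = det2 (y - z) (y - L k p)" by blast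
          let ?V = "{v \<in> V. g v = 0}"
          have "dim ?V < dim V"
            by (rule dim_kernel_less[OF insert.prems(5) g v0(1)]) (use v0 elim in simp)
          then have "dim ?V < (\<Sum>k\<in>K. if i k = j k then 2 else 1)"
            using insert.prems(6) insert.hyps False by simp
          from IH[OF subspace_kernel_Int[OF insert.prems(5) g] this, of "p + v0"]
          have "AE x in Pi\<^sub>M ?J (\<lambda>_. lborel). ?P ?V (p + v0) x" .
          then show ?thesis
          proof eventually_elim
            case (elim x)
            show ?case
            proof
              assume "\<exists>v\<in>V. \<forall>k'\<in>insert k K. incident (i k') (j k') (x(?b := z, ?a := y)) (L k' (p + v))"
              then obtain v where v: "v \<in> V" "g v = g v0"
                  "\<And>k'. k' \<in> K \<Longrightarrow> incident (i k') (j k') x (L k' (p + v))"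
                using v0(2) by (auto simp: upd inc)
              have "v - v0 \<in> ?V"
                using v v0 insert.prems(5) by (auto simp: subspace_diff linear_diff[OF g])
              then show False
                using elim v(3) by (auto simp: algebra_simps)
            qed
          qed
        qed
      qed
      then show ?case
        using insert.prems(2) False by (intro AE_PiM_insert meas') auto
    qed
    then have "AE x in Pi\<^sub>M (insert ?a (insert ?b ?J)) (\<lambda>_. lborel). ?Q x"
      using insert.prems(2) False by (intro AE_PiM_insert meas) auto
    then show ?thesis unfolding I[symmetric] .
  qed
qed simp

section \<open>Colourful Caratheodory theorem\<close>

text \<open>Gaussian elimination, by induction on the set of equations: each step uses up one
  equation and at most one unknown.\<close>

lemma homogeneous_system_nontrivial:
  fixes a :: "'j \<Rightarrow> 'i \<Rightarrow> 'a::field"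
  assumes "finite J" "finite I" "card J < card I"
  obtains \<mu> where "\<And>j. j \<in> J \<Longrightarrow> (\<Sum>i\<in>I. \<mu> i * a j i) = 0" "\<exists>i\<in>I. \<mu> i \<noteq> 0"
proof -
  have "\<exists>\<mu>. (\<forall>j\<in>J. (\<Sum>i\<in>I. \<mu> i * a j i) = 0) \<and> (\<exists>i\<in>I. \<mu> i \<noteq> 0)"
    using assms
  proof (induction J arbitrary: I a rule: finite_induct)
    case empty
    then show ?case by (auto intro!: exI[of _ "\<lambda>_. 1"] simp: card_gt_0_iff)
  next
    case (insert j J)
    show ?case
    proof (cases "\<forall>i\<in>I. a j i = 0")
      case True
      from insert.IH[of I a] insert.prems insert.hyps
      obtain \<mu> where "\<forall>j\<in>J. (\<Sum>i\<in>I. \<mu> i * a j i) = 0" "\<exists>i\<in>I. \<mu> i \<noteq> 0" by auto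
      with True show ?thesis by (intro exI[of _ \<mu>]) auto
    next
      case False
      then obtain s where s: "s \<in> I" "a j s \<noteq> 0" by blast
      \<comment> \<open>The coefficients of equation \<open>l\<close> after the pivot unknown
        \<open>s\<close> has been eliminated by means of equation \<open>j\<close>.\<close>
      let ?b = "\<lambda>l i. a l i - a j i / a j s * a l s"
      have "card J < card (I - {s})"
        using insert.prems insert.hyps s(1) by (simp add: card_Diff_singleton)
      from insert.IH[OF _ this, of ?b] insert.prems
      obtain \<mu> where \<mu>: "\<And>l. l \<in> J \<Longrightarrow> (\<Sum>i\<in>I-{s}. \<mu> i * ?b l i) = 0" "\<exists>i\<in>I-{s}. \<mu> i \<noteq> 0" by auto
      let ?S = "\<Sum>i\<in>I-{s}. \<mu> i * a j i"
      \<comment> \<open>Back-substitution: the value at \<open>s\<close> is the one that solves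
        equation \<open>j\<close>.\<close>
      define \<nu> where "\<nu> = \<mu>(s := - ?S / a j s)"
      have split: "(\<Sum>i\<in>I. \<nu> i * a l i) = - ?S / a j s * a l s + (\<Sum>i\<in>I-{s}. \<mu> i * a l i)" for l
        using insert.prems(1) s(1) by (subst sum.remove[of _ s]) (auto simp: \<nu>_def intro!: sum.cong)
      have "(\<Sum>i\<in>I. \<nu> i * a l i) = 0" if "l \<in> insert j J" for l
      proof (cases "l = j")
        case True
        then show ?thesis using s(2) by (simp add: split)
      next
        case False
        then have "0 = (\<Sum>i\<in>I-{s}. \<mu> i * ?b l i)" using \<mu>(1)[of l] that by simp
        also have "\<dots> = (\<Sum>i\<in>I-{s}. \<mu> i * a l i) - ?S / a j s * a l s"
          by (simp add: algebra_simps sum_subtractf sum_distrib_left sum_divide_distrib)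
        finally show ?thesis by (simp add: split)
      qed
      moreover have "\<exists>i\<in>I. \<nu> i \<noteq> 0" using \<mu>(2) by (auto simp: \<nu>_def)
      ultimately show ?thesis by blast
    qed
  qed
  then show thesis using that by blast
qed

lemma sum_mult_sum:
  fixes b :: "'j \<Rightarrow> 'a::comm_semiring_0"
  shows "(\<Sum>j\<in>J. b j * (\<Sum>i\<in>A. c i * u i j)) = (\<Sum>i\<in>A. c i * (\<Sum>j\<in>J. b j * u i j))"
  by (simp add: sum_distrib_left mult_ac) (rule sum.swap)

text \<open>Barany's argument. Here \<open>i\<close> is a colour and \<open>\<kappa> i\<close> picks
  a vector of that colour. Choose picks and convex weights whose weighted sum is nearest to the
  origin. If it is not the origin, it can be written without some colour, and exchanging the pick of
  that colour brings it nearer.\<close>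

theorem colorful_caratheodory:
  fixes v :: "'i \<Rightarrow> 'k \<Rightarrow> 'j \<Rightarrow> real"
  assumes fin: "finite I" "finite J" "finite K" and card: "card J < card I"
    and \<alpha>: "\<And>i k. i \<in> I \<Longrightarrow> k \<in> K \<Longrightarrow> \<alpha> i k \<ge> 0" "\<And>i. i \<in> I \<Longrightarrow> (\<Sum>k\<in>K. \<alpha> i k) = 1"
    and zero: "\<And>i j. i \<in> I \<Longrightarrow> j \<in> J \<Longrightarrow> (\<Sum>k\<in>K. \<alpha> i k * v i k j) = 0"
  obtains \<kappa> \<xi> where "\<kappa> \<in> I \<rightarrow> K" "\<And>i. i \<in> I \<Longrightarrow> \<xi> i \<ge> 0" "(\<Sum>i\<in>I. \<xi> i) = 1"
    "\<And>j. j \<in> J \<Longrightarrow> (\<Sum>i\<in>I. \<xi> i * v i (\<kappa> i) j) = 0"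
proof -
  define w where "w = (\<lambda>\<kappa> \<xi> j. \<Sum>i\<in>I. \<xi> i * v i (\<kappa> i) j)"
  define Q where "Q = (\<lambda>\<kappa> \<xi>. \<Sum>j\<in>J. (w \<kappa> \<xi> j)\<^sup>2)"
  define D where "D = {\<xi> :: 'i \<Rightarrow> real. (\<forall>i\<in>I. \<xi> i \<ge> 0) \<and> (\<Sum>i\<in>I. \<xi> i) = 1}"
  have Q_cong: "Q \<kappa> \<xi> = Q \<kappa>' \<xi>'" if "\<And>i. i \<in> I \<Longrightarrow> \<kappa> i = \<kappa>' i" "\<And>i. i \<in> I \<Longrightarrow> \<xi> i = \<xi>' i" for \<kappa> \<xi> \<kappa>' \<xi>'
    using that by (simp add: Q_def w_def cong: sum.cong)
  have "I \<noteq> {}" using card by auto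
  then obtain i0 where i0: "i0 \<in> I" by blast
  have "K \<noteq> {}" using \<alpha>(2)[OF i0] by auto
  \<comment> \<open>Weights are normalised to 0 off \<open>I\<close>, so that they form a compact
    subset of the whole function space.\<close>
  define C where "C = D \<inter> Pi UNIV (\<lambda>i. if i \<in> I then {0..1} else {0})"
  have "compact (Pi\<^sub>E UNIV (\<lambda>i. if i \<in> I then {0..1} else {0 :: real}))"
    unfolding euclidean_product_topology[symmetric] compactin_euclidean_iff[symmetric]
    by (subst compactin_PiE) (auto simp: compactin_euclidean_iff)
  moreover have "D = (\<Inter>i\<in>I. {\<xi>. \<xi> i \<ge> 0}) \<inter> {\<xi>. (\<Sum>i\<in>I. \<xi> i) = 1}"
    by (auto simp: D_def)
  then have "closed D"
    by (auto intro!: closed_Int closed_INT closed_Collect_le closed_Collect_eq continuous_intros)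
  ultimately have C: "compact C"
    unfolding C_def by (simp add: PiE_UNIV_domain closed_Int_compact)
  have "(\<lambda>i. if i = i0 then 1 else 0) \<in> C"
    using i0 fin(1) by (auto simp: C_def D_def)
  then have "C \<noteq> {}" by blast
  have "continuous_on C (Q \<kappa>)" for \<kappa>
    unfolding Q_def w_def
    by (intro continuous_intros continuous_on_subset[OF continuous_on_product_coordinates]) auto
  then have "\<exists>\<xi>\<in>C. \<forall>\<xi>'\<in>C. Q \<kappa> \<xi> \<le> Q \<kappa> \<xi>'" for \<kappa>
    by (rule continuous_attains_inf[OF C \<open>C \<noteq> {}\<close>])
  then obtain m where m: "\<And>\<kappa>. m \<kappa> \<in> C" "\<And>\<kappa> \<xi>. \<xi> \<in> C \<Longrightarrow> Q \<kappa> (m \<kappa>) \<le> Q \<kappa> \<xi>" by metis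
  \<comment> \<open>For each pick the weights are already optimal; now the best of the finitely many
    picks is taken.\<close>
  have "finite (I \<rightarrow>\<^sub>E K)" "I \<rightarrow>\<^sub>E K \<noteq> {}"
    using fin \<open>K \<noteq> {}\<close> by (auto intro: finite_PiE simp: PiE_eq_empty_iff)
  then obtain \<kappa> where \<kappa>: "\<kappa> \<in> I \<rightarrow>\<^sub>E K" "\<And>\<kappa>'. \<kappa>' \<in> I \<rightarrow>\<^sub>E K \<Longrightarrow> Q \<kappa> (m \<kappa>) \<le> Q \<kappa>' (m \<kappa>')"
    using arg_min_if_finite[of "I \<rightarrow>\<^sub>E K" "\<lambda>\<kappa>. Q \<kappa> (m \<kappa>)"] by (metis not_le)
  define \<xi> where "\<xi> = m \<kappa>"
  have \<xi>: "\<xi> \<in> D" using m(1) by (auto simp: \<xi>_def C_def)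
  have min: "Q \<kappa> \<xi> \<le> Q \<kappa>' \<xi>'" if "\<kappa>' \<in> I \<rightarrow> K" "\<xi>' \<in> D" for \<kappa>' \<xi>'
  proof -
    let ?\<kappa> = "restrict \<kappa>' I" and ?\<xi> = "\<lambda>i. if i \<in> I then \<xi>' i else 0"
    have "\<xi>' i \<le> 1" if "i \<in> I" for i
      using member_le_sum[of i I \<xi>'] \<open>\<xi>' \<in> D\<close> that fin(1) by (auto simp: D_def)
    then have "?\<xi> \<in> C" using that(2) by (auto simp: C_def D_def cong: sum.cong)
    have "Q \<kappa> \<xi> \<le> Q ?\<kappa> (m ?\<kappa>)"
      unfolding \<xi>_def using that(1) by (intro \<kappa>(2)) auto
    also have "\<dots> \<le> Q ?\<kappa> ?\<xi>" by (rule m(2)) fact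
    also have "\<dots> = Q \<kappa>' \<xi>'" by (rule Q_cong) auto
    finally show ?thesis .
  qed
  define b where "b = w \<kappa> \<xi>"
  define ip where "ip = (\<lambda>u. \<Sum>j\<in>J. b j * u j)"
  have ip_b: "ip b = Q \<kappa> \<xi>" by (simp add: ip_def Q_def b_def power2_eq_square)
  have "Q \<kappa> \<xi> = 0"
  proof (rule ccontr)
    assume "Q \<kappa> \<xi> \<noteq> 0"
    then have pos: "Q \<kappa> \<xi> > 0" by (simp add: Q_def sum_nonneg less_le)
    text \<open>Every point that can replace the one of colour \<^term>\<open>i\<close> without changing the nearest point \<^term>\<open>b\<close>
      lies beyond the supporting hyperplane of \<^term>\<open>b\<close>.\<close>
    have supp: "ip (v i k) \<ge> Q \<kappa> \<xi>"
      if i: "i \<in> I" and k: "k \<in> K" and \<xi>': "\<xi>' \<in> D" "\<forall>j\<in>J. w \<kappa> \<xi>' j = b j" and ok: "k = \<kappa> i \<or> \<xi>' i = 0" for i k \<xi>'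
    proof (rule ccontr)
      assume less: "\<not> ip (v i k) \<ge> Q \<kappa> \<xi>"
      let ?\<kappa> = "\<kappa>(i := k)"
      \<comment> \<open>Moving weight \<open>t\<close> to colour \<open>i\<close> shifts the sum
        from \<open>b\<close> towards \<open>v i k\<close>. Changing the pick to \<open>k\<close>
        does not disturb \<open>b\<close>, as \<open>ok\<close> says that the pick is unchanged or
        carries no weight.\<close>
      define L where "L t = (\<lambda>l. (1 - t) * \<xi>' l + (if l = i then t else 0))" for t :: real
      have w: "w ?\<kappa> (L t) j = b j + t * (v i k j - b j)" if "j \<in> J" for t j
      proof -
        have "w ?\<kappa> (L t) j = (1 - t) * (\<Sum>l\<in>I. \<xi>' l * v l (?\<kappa> l) j) + (\<Sum>l\<in>I. (if l = i then t * v i k j else 0))"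
          unfolding w_def L_def sum_distrib_left sum.distrib[symmetric]
          by (intro sum.cong) (auto simp: algebra_simps)
        also have "(\<Sum>l\<in>I. \<xi>' l * v l (?\<kappa> l) j) = w \<kappa> \<xi>' j"
          unfolding w_def using ok by (intro sum.cong) auto
        also have "\<dots> = b j" using \<xi>'(2) that by blast
        finally show ?thesis using fin(1) i by (simp add: algebra_simps fun_upd_def)
      qed
      have LD: "L t \<in> D" if "0 \<le> t" "t \<le> 1" for t
        using that \<xi>'(1) fin(1) i by (auto simp: D_def L_def sum.distrib simp flip: sum_distrib_left)
      define E where "E = (\<Sum>j\<in>J. (v i k j - b j)\<^sup>2)"
      define c where "c = Q \<kappa> \<xi> - ip (v i k)"
      have "c > 0" using less by (simp add: c_def)
      have "E \<ge> 0" by (simp add: E_def sum_nonneg)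
      have QL: "Q ?\<kappa> (L t) = Q \<kappa> \<xi> - 2 * t * c + t\<^sup>2 * E" for t
      proof -
        have "Q ?\<kappa> (L t) = (\<Sum>j\<in>J. (b j)\<^sup>2 - 2 * t * (b j * b j - b j * v i k j) + t\<^sup>2 * (v i k j - b j)\<^sup>2)"
          unfolding Q_def by (intro sum.cong) (auto simp: w power2_eq_square algebra_simps)
        also have "\<dots> = (\<Sum>j\<in>J. (b j)\<^sup>2) - 2 * t * (ip b - ip (v i k)) + t\<^sup>2 * E"
          by (simp add: sum.distrib sum_subtractf ip_def E_def flip: sum_distrib_left)
        finally show ?thesis by (simp add: c_def ip_b) (simp add: Q_def b_def)
      qed
      \<comment> \<open>Small enough for the linear gain \<open>2 * t * c\<close> to beat the
        quadratic term; the bound 1 keeps the weights in \<open>D\<close>, and \<open>E + 1\<close>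
        avoids division by zero.\<close>
      define t where "t = min 1 (c / (E + 1))"
      have t: "0 < t" "t \<le> 1" using \<open>c > 0\<close> \<open>E \<ge> 0\<close> by (auto simp: t_def)
      have "t * E \<le> c / (E + 1) * E"
        using \<open>E \<ge> 0\<close> by (intro mult_right_mono) (auto simp: t_def)
      also have "\<dots> \<le> c" using \<open>c > 0\<close> \<open>E \<ge> 0\<close> by (simp add: field_simps)
      finally have "t * (t * E) < t * (2 * c)" using t \<open>c > 0\<close> by (intro mult_strict_left_mono) auto
      then have "Q ?\<kappa> (L t) < Q \<kappa> \<xi>" by (simp add: QL power2_eq_square algebra_simps)
      moreover have "Q \<kappa> \<xi> \<le> Q ?\<kappa> (L t)"
        using \<kappa>(1) k t by (intro min LD) auto
      ultimately show False by simp
    qed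
    have ip_sum: "ip (\<lambda>j. \<Sum>i\<in>I. c i * u i j) = (\<Sum>i\<in>I. c i * ip (u i))" for c u
      unfolding ip_def by (rule sum_mult_sum)
    have "\<exists>\<xi>'\<in>D. (\<forall>j\<in>J. w \<kappa> \<xi>' j = b j) \<and> (\<exists>i\<in>I. \<xi>' i = 0)"
    proof (cases "\<exists>i\<in>I. \<xi> i = 0")
      case True
      then show ?thesis using \<xi> b_def by blast
    next
      case False
      then have \<xi>pos: "\<xi> i > 0" if "i \<in> I" for i using \<xi> that by (auto simp: D_def less_le)
      have on: "ip (v i (\<kappa> i)) = Q \<kappa> \<xi>" if "i \<in> I" for i
      proof -
        have ge: "ip (v l (\<kappa> l)) - Q \<kappa> \<xi> \<ge> 0" if "l \<in> I" for l
          using supp[OF that _ \<xi>] \<kappa>(1) that b_def by auto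
        have "(\<Sum>l\<in>I. \<xi> l * (ip (v l (\<kappa> l)) - Q \<kappa> \<xi>)) = ip b - Q \<kappa> \<xi>"
          using \<xi> ip_sum[of \<xi> "\<lambda>l. v l (\<kappa> l)"]
          by (simp add: D_def algebra_simps sum_subtractf b_def w_def flip: sum_distrib_right)
        then have "(\<Sum>l\<in>I. \<xi> l * (ip (v l (\<kappa> l)) - Q \<kappa> \<xi>)) = 0" by (simp add: ip_b)
        then have "\<xi> i * (ip (v i (\<kappa> i)) - Q \<kappa> \<xi>) = 0"
          using fin(1) that ge \<xi>pos by (subst (asm) sum_nonneg_eq_0_iff) (auto simp: less_imp_le)
        then show ?thesis using \<xi>pos[OF that] by simp
      qed
      obtain \<mu> where \<mu>: "\<And>j. j \<in> J \<Longrightarrow> (\<Sum>i\<in>I. \<mu> i * v i (\<kappa> i) j) = 0" "\<exists>i\<in>I. \<mu> i \<noteq> 0"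
        using homogeneous_system_nontrivial[OF fin(2,1) card, of "\<lambda>j i. v i (\<kappa> i) j"] by blast
      have "0 = ip (\<lambda>j. \<Sum>i\<in>I. \<mu> i * v i (\<kappa> i) j)"
        using \<mu>(1) by (simp add: ip_def)
      \<comment> \<open>As \<open>ip\<close> has the same positive value at all picked vectors, the
        coefficients of the dependence sum to zero, so adding a multiple of it preserves the total
        weight.\<close>
      also have "\<dots> = (\<Sum>i\<in>I. \<mu> i) * Q \<kappa> \<xi>"
        unfolding ip_sum sum_distrib_right by (intro sum.cong) (auto simp: on)
      finally have \<mu>0: "(\<Sum>i\<in>I. \<mu> i) = 0" using pos by simp
      have "\<exists>i\<in>I. \<mu> i < 0"
        using \<mu>(2) \<mu>0 fin(1) sum_nonneg_eq_0_iff[of I \<mu>] by (meson not_le)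
      define N where "N = {i \<in> I. \<mu> i < 0}"
      have N: "finite N" "N \<noteq> {}" using fin(1) \<open>\<exists>i\<in>I. \<mu> i < 0\<close> by (auto simp: N_def)
      \<comment> \<open>The longest step that keeps all weights nonnegative; it is attained at a
        weight that becomes zero.\<close>
      define s where "s = Min ((\<lambda>i. \<xi> i / - \<mu> i) ` N)"
      have "s \<in> (\<lambda>i. \<xi> i / - \<mu> i) ` N" unfolding s_def using N by (intro Min_in) auto
      then obtain i1 where i1: "i1 \<in> N" "s = \<xi> i1 / - \<mu> i1" by blast
      have s: "s \<le> \<xi> i / - \<mu> i" if "i \<in> N" for i unfolding s_def using N that by (intro Min_le) auto
      have "s > 0" using i1 \<xi>pos by (auto simp: N_def divide_pos_neg)
      define \<xi>' where "\<xi>' i = \<xi> i + s * \<mu> i" for i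
      have "\<xi>' i \<ge> 0" if "i \<in> I" for i
      proof (cases "\<mu> i < 0")
        case True
        then show ?thesis using s[of i] that by (simp add: N_def \<xi>'_def field_simps)
      next
        case False
        then show ?thesis using \<open>s > 0\<close> \<xi>pos[OF that] by (simp add: \<xi>'_def)
      qed
      moreover have "(\<Sum>i\<in>I. \<xi>' i) = 1"
        using \<xi> \<mu>0 by (simp add: \<xi>'_def D_def sum.distrib flip: sum_distrib_left)
      moreover have "w \<kappa> \<xi>' j = b j" if "j \<in> J" for j
        using \<mu>(1)[OF that]
        by (simp add: w_def b_def \<xi>'_def algebra_simps sum.distrib flip: sum_distrib_left)
      moreover have "\<xi>' i1 = 0" using i1 by (simp add: \<xi>'_def N_def field_simps)
      ultimately show ?thesis using i1(1) by (auto simp: D_def N_def)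
    qed
    then obtain \<xi>' i where i: "\<xi>' \<in> D" "\<forall>j\<in>J. w \<kappa> \<xi>' j = b j" "i \<in> I" "\<xi>' i = 0" by blast
    \<comment> \<open>Colour \<open>i\<close> carries no weight, so all its vectors lie beyond the
      hyperplane; but their \<open>\<alpha>\<close>-average is the origin, which does not.\<close>
    then have "Q \<kappa> \<xi> \<le> ip (v i k)" if "k \<in> K" for k using supp that by blast
    then have "(\<Sum>k\<in>K. \<alpha> i k * Q \<kappa> \<xi>) \<le> (\<Sum>k\<in>K. \<alpha> i k * ip (v i k))"
      using \<alpha>(1)[OF i(3)] by (intro sum_mono mult_left_mono) auto
    also have "\<dots> = ip (\<lambda>j. \<Sum>k\<in>K. \<alpha> i k * v i k j)" unfolding ip_def by (rule sum_mult_sum[symmetric])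
    also have "\<dots> = 0" using zero[OF i(3)] by (simp add: ip_def)
    finally show False using \<alpha>(2)[OF i(3)] pos by (simp flip: sum_distrib_right)
  qed
  then have "b j = 0" if "j \<in> J" for j
    using fin(2) that by (simp add: Q_def sum_nonneg_eq_0_iff b_def)
  then show thesis
    using that[of \<kappa> \<xi>] \<kappa>(1) \<xi> by (auto simp: b_def w_def D_def)
qed

section \<open>Polygon partitions\<close>

lemma incident_convex_hull:
  assumes "q \<in> convex hull {x i, x j}"
  shows "incident i j x q"
proof (cases "i = j")
  case True
  then show ?thesis using assms by (simp add: incident_def)
next
  case False
  from assms obtain u where "q = (1 - u) *\<^sub>R x i + u *\<^sub>R x j"
    unfolding segment_convex_hull[symmetric] in_segment by blast
  then have "x i - q = u *\<^sub>R (x i - x j)" by (simp add: algebra_simps)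
  then show ?thesis using False by (simp add: incident_def det2_def)
qed

text \<open>A class of \<open>m \<le> 3\<close> points imposes \<open>3 - m\<close> conditions on its vertex, and larger classes impose none,
  so \<open>r\<close> classes impose at least \<open>3 r - card I\<close> conditions.\<close>
theorem AE_no_flat_transversal:
  fixes L :: "nat \<Rightarrow> 'e::euclidean_space \<Rightarrow> real^2" and I :: "'i::countable set"
  assumes "finite I" and lin: "\<And>k. k < r \<Longrightarrow> linear (L k)" and V: "subspace V"
    and dim: "dim V + card I < 3 * r"
  shows "AE x in Pi\<^sub>M I (\<lambda>_. lborel). \<forall>A v. disjoint_family_on A {..<r} \<longrightarrow> (\<Union>k<r. A k) \<subseteq> I \<longrightarrow>
    v \<in> V \<longrightarrow> (\<exists>k<r. L k v \<notin> convex hull (x ` A k))"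
proof -
  \<comment> \<open>Extensional functions leave only finitely many triples \<open>K\<close>,
    \<open>i\<close>, \<open>j\<close>, so one null set serves all of them.\<close>
  let ?F = "{..<r} \<rightarrow>\<^sub>E I"
  let ?D = "\<lambda>K i j. disjoint_family_on (\<lambda>k. {i k, j k}) K \<and>
    dim V < (\<Sum>k\<in>K. if i k = j k then 2 else 1)"
  have "finite ?F" using assms(1) by (intro finite_PiE) auto
  have "AE x in Pi\<^sub>M I (\<lambda>_. lborel). ?D K i j \<longrightarrow>
      \<not> (\<exists>v\<in>V. \<forall>k\<in>K. incident (i k) (j k) x (L k v))"
    if "K \<in> Pow {..<r}" "i \<in> ?F" "j \<in> ?F" for K i j
  proof (cases "?D K i j")
    case True
    have "AE x in Pi\<^sub>M I (\<lambda>_. lborel). \<not> (\<exists>v\<in>V. \<forall>k\<in>K. incident (i k) (j k) x (L k (0 + v)))"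
      using that True assms(1) V by (intro AE_no_incident) (auto intro: finite_subset lin)
    then show ?thesis by (auto elim: eventually_mono)
  next
    case False
    then show ?thesis by (intro AE_I2) blast
  qed
  then have "AE x in Pi\<^sub>M I (\<lambda>_. lborel). \<forall>K\<in>Pow {..<r}. \<forall>i\<in>?F. \<forall>j\<in>?F. ?D K i j \<longrightarrow>
      \<not> (\<exists>v\<in>V. \<forall>k\<in>K. incident (i k) (j k) x (L k v))"
    by (intro AE_finite_allI \<open>finite ?F\<close>) simp_all
  then show ?thesis
  proof eventually_elim
    case (elim x)
    show ?case
    proof (intro allI impI, rule ccontr)
      fix A v
      assume disj: "disjoint_family_on A {..<r}" and sub: "(\<Union>k<r. A k) \<subseteq> I" and v: "v \<in> V"
        and "\<not> (\<exists>k<r. L k v \<notin> convex hull (x ` A k))"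
      then have hull: "L k v \<in> convex hull (x ` A k)" if "k < r" for k using that by blast
      have fin: "finite (A k)" and ne: "A k \<noteq> {}" if "k < r" for k
        using that sub assms(1) hull[OF that] by (auto intro: finite_subset)
      \<comment> \<open>The classes that impose conditions, each to be written as
        \<open>{i k, j k}\<close>, with \<open>i k = j k\<close> for a single point.\<close>
      define K where "K = {k. k < r \<and> card (A k) \<le> 2}"
      have "\<exists>i j. i \<in> A k \<and> j \<in> A k \<and> (card (A k) \<le> 2 \<longrightarrow> A k = {i, j})" if "k < r" for k
      proof (cases "card (A k) \<le> 2")
        case True
        moreover have "card (A k) \<noteq> 0" using fin ne that by simp
        ultimately have "card (A k) = 1 \<or> card (A k) = 2" by linarith
        then show ?thesis by (auto simp: card_1_singleton_iff card_2_iff)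
      next
        case False
        then show ?thesis using ne[OF that] by auto
      qed
      then obtain i j where ij: "\<And>k. k < r \<Longrightarrow> i k \<in> A k" "\<And>k. k < r \<Longrightarrow> j k \<in> A k"
          "\<And>k. k \<in> K \<Longrightarrow> A k = {i k, j k}"
        unfolding K_def by (metis (no_types, lifting) mem_Collect_eq)
      have ijI: "i k \<in> I" "j k \<in> I" if "k < r" for k using ij(1,2)[OF that] that sub by blast+
      let ?i = "restrict i {..<r}" and ?j = "restrict j {..<r}"
      have K: "K \<subseteq> {..<r}" by (auto simp: K_def)
      have eq: "{?i k, ?j k} = A k" if "k \<in> K" for k using that ij(3)[OF that] K by auto
      have "disjoint_family_on (\<lambda>k. {?i k, ?j k}) K"
        using disj K eq unfolding disjoint_family_on_def by (metis lessThan_iff subset_iff)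
      moreover have "dim V < (\<Sum>k\<in>K. if ?i k = ?j k then 2 else 1)"
      proof -
        let ?w = "\<lambda>k. if ?i k = ?j k then 2 else (1 :: nat)"
        \<comment> \<open>Points plus conditions: 1 + 2 for a singleton, 2 + 1 for a pair, and at
          least 3 points otherwise.\<close>
        have "3 \<le> card (A k) + (if k \<in> K then ?w k else 0)" if "k < r" for k
          using eq[of k, symmetric] that by (cases "k \<in> K") (auto simp: K_def)
        then have "(\<Sum>k<r. 3) \<le> (\<Sum>k<r. card (A k) + (if k \<in> K then ?w k else 0))"
          by (intro sum_mono) auto
        also have "\<dots> = card (\<Union>k<r. A k) + sum ?w K"
          using K disj fin
          by (simp add: sum.distrib sum.If_cases Int_absorb1 card_UN_disjoint disjoint_family_on_def)
        also have "card (\<Union>k<r. A k) \<le> card I" using sub assms(1) by (rule card_mono[rotated])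
        finally show ?thesis using dim by simp
      qed
      moreover have "K \<in> Pow {..<r}" "?i \<in> ?F" "?j \<in> ?F" using K ijI by auto
      ultimately have "\<not> (\<exists>v\<in>V. \<forall>k\<in>K. incident (?i k) (?j k) x (L k v))"
        using elim by blast
      moreover have "incident (?i k) (?j k) x (L k v)" if "k \<in> K" for k
        using hull[of k] eq[OF that, symmetric] that K by (intro incident_convex_hull) auto
      ultimately show False using v by blast
    qed
  qed
qed

text \<open>A coincidence \<open>x i = x j\<close> is a point of the plane, with two parameters,
  incident with two singleton classes, which impose four conditions.\<close>

lemma AE_inj_on:
  assumes "finite (I :: 'i::countable set)"
  shows "AE x in Pi\<^sub>M I (\<lambda>_. lborel :: (real^2) measure). inj_on x I"
proof -
  have "AE x in Pi\<^sub>M I (\<lambda>_. lborel :: (real^2) measure). i \<noteq> j \<longrightarrow> x i \<noteq> x j" if "i \<in> I" "j \<in> I" for i j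
  proof (cases "i = j")
    case False
    have "AE x in Pi\<^sub>M I (\<lambda>_. lborel). \<not> (\<exists>v\<in>UNIV. \<forall>k\<in>{i, j}. incident k k x (0 + v :: real^2))"
      using that False assms
      by (intro AE_no_incident[where L = "\<lambda>_ q. q"]) (auto simp: disjoint_family_on_def linear_iff)
    then show ?thesis by eventually_elim (auto simp: incident_def)
  qed simp
  then have "AE x in Pi\<^sub>M I (\<lambda>_. lborel :: (real^2) measure). \<forall>i\<in>I. \<forall>j\<in>I. i \<noteq> j \<longrightarrow> x i \<noteq> x j"
    by (intro AE_finite_allI assms) auto
  then show ?thesis by eventually_elim (auto simp: inj_on_def)
qed

section \<open>Regular polygons as a linear family in the complex plane\<close>

definition to_complex :: "real^2 \<Rightarrow> complex" where
  "to_complex q = Complex (q $ 1) (q $ 2)"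

definition of_complex :: "complex \<Rightarrow> real^2" where
  "of_complex z = vector [Re z, Im z]"

lemma to_of_complex [simp]: "to_complex (of_complex z) = z"
  by (simp add: to_complex_def of_complex_def)

lemma of_to_complex [simp]: "of_complex (to_complex q) = q"
  by (simp add: to_complex_def of_complex_def vec_eq_iff forall_2)

lemma to_complex_linear:
  "to_complex (p + q) = to_complex p + to_complex q"
  "to_complex (c *\<^sub>R q) = of_real c * to_complex q"
  by (auto simp: to_complex_def complex_eq_iff)

lemma of_complex_linear:
  "of_complex (y + z) = of_complex y + of_complex z"
  "of_complex (of_real c * z) = c *\<^sub>R of_complex z"
  by (auto simp: of_complex_def vec_eq_iff forall_2)

lemma of_complex_inject [simp]: "of_complex y = of_complex z \<longleftrightarrow> y = z"
  by (metis to_of_complex)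

lemma complex_plane_eq_0 [simp]:
  "to_complex q = 0 \<longleftrightarrow> q = 0" "of_complex z = 0 \<longleftrightarrow> z = 0"
  by (simp_all add: to_complex_def of_complex_def complex_eq_iff vec_eq_iff forall_2)

lemma to_complex_sum: "to_complex (\<Sum>i\<in>A. f i) = (\<Sum>i\<in>A. to_complex (f i))"
  by (induction A rule: infinite_finite_induct) (simp_all add: to_complex_linear)

text \<open>The parameters are the centre and the vector from it to vertex 0. Unlike radius and
  angle, they make each vertex a linear function on a space of dimension four; \<open>z = 0\<close>
  gives the degenerate polygons.\<close>

definition vertex :: "nat \<Rightarrow> nat \<Rightarrow> (real^2) \<times> (real^2) \<Rightarrow> real^2" where
  "vertex r k = (\<lambda>(c, z). c + of_complex (cis (2 * pi * real k / real r) * to_complex z))"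

lemma linear_vertex: "linear (vertex r k)"
  by (intro linearI)
    (auto simp: vertex_def to_complex_linear algebra_simps of_complex_linear simp flip: of_complex_linear(2))

lemma vertex_polar:
  "vertex r k (c, of_complex (rcis \<rho> \<theta>)) =
    c + \<rho> *\<^sub>R vector [cos (\<theta> + 2 * pi * real k / real r), sin (\<theta> + 2 * pi * real k / real r)]"
  by (simp add: vertex_def) (simp add: of_complex_def rcis_def vec_eq_iff forall_2 cos_add sin_add algebra_simps)

text \<open>Polar coordinates of \<open>z\<close> are the circumradius and the orientation.\<close>

lemma regular_polygon_vertices_iff:
  "regular_polygon_vertices r V \<longleftrightarrow> (\<exists>c z. z \<noteq> 0 \<and> V = (\<lambda>k. vertex r k (c, z)) ` {..<r})"
proof
  assume "regular_polygon_vertices r V"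
  then obtain c \<rho> \<theta> where "\<rho> > 0" "V = (\<lambda>k. vertex r k (c, of_complex (rcis \<rho> \<theta>))) ` {..<r}"
    unfolding regular_polygon_vertices_def vertex_polar by blast
  moreover from \<open>\<rho> > 0\<close> have "of_complex (rcis \<rho> \<theta>) \<noteq> 0"
    by (simp add: rcis_def)
  ultimately show "\<exists>c z. z \<noteq> 0 \<and> V = (\<lambda>k. vertex r k (c, z)) ` {..<r}" by blast
next
  assume "\<exists>c z. z \<noteq> 0 \<and> V = (\<lambda>k. vertex r k (c, z)) ` {..<r}"
  then obtain c z where z: "z \<noteq> 0" "V = (\<lambda>k. vertex r k (c, z)) ` {..<r}" by blast
  have "z = of_complex (rcis (cmod (to_complex z)) (Arg (to_complex z)))"
    by (simp add: rcis_cmod_Arg)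
  moreover have "cmod (to_complex z) > 0"
    using z(1) by simp
  ultimately show "regular_polygon_vertices r V"
    unfolding regular_polygon_vertices_def vertex_polar[symmetric] using z(2) by metis
qed

lemma inj_on_cis_roots_unity:
  assumes "r > 0"
  shows "inj_on (\<lambda>k. cis (2 * pi * real k / real r)) {..<r}"
  using Complex.bij_betw_roots_unity[OF assms] by (rule bij_betw_imp_inj_on)

lemma inj_on_vertex:
  assumes "r > 0" "z \<noteq> 0"
  shows "inj_on (\<lambda>k. vertex r k (c, z)) {..<r}"
proof (rule inj_onI)
  fix k l assume kl: "k \<in> {..<r}" "l \<in> {..<r}" "vertex r k (c, z) = vertex r l (c, z)"
  then have "cis (2 * pi * real k / real r) = cis (2 * pi * real l / real r)"
    using assms(2) by (simp add: vertex_def)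
  then show "k = l"
    using inj_onD[OF inj_on_cis_roots_unity[OF assms(1)]] kl(1,2) by blast
qed

text \<open>The characteristic polynomial has the distinct roots 1 and \<open>\<omega>\<close>, so
  the first two terms determine \<open>a\<close> and \<open>b\<close>.\<close>

lemma second_order_recurrence:
  fixes Y :: "nat \<Rightarrow> 'a::field"
  assumes "\<omega> \<noteq> 1" "\<And>m. m + 2 < r \<Longrightarrow> Y (m + 2) = (1 + \<omega>) * Y (m + 1) - \<omega> * Y m"
  obtains a b where "\<And>m. m < r \<Longrightarrow> Y m = a + b * \<omega> ^ m"
proof -
  define b where "b = (Y 1 - Y 0) / (\<omega> - 1)"
  define a where "a = Y 0 - b"
  have b: "b * (\<omega> - 1) = Y 1 - Y 0" using assms(1) by (simp add: b_def)
  have "Y m = a + b * \<omega> ^ m" if "m < r" for m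
    using that
  proof (induction m rule: less_induct)
    case (less m)
    consider "m = 0" | "m = 1" | n where "m = n + 2"
      by (metis One_nat_def add_2_eq_Suc' not0_implies_Suc)
    then show ?case
    proof cases
      case 3
      then have "Y m = (1 + \<omega>) * (a + b * \<omega> ^ (n + 1)) - \<omega> * (a + b * \<omega> ^ n)"
        using assms(2)[of n] less.IH[of n] less.IH[of "n + 1"] less.prems by simp
      then show ?thesis using 3 by (simp add: algebra_simps)
    qed (use b in \<open>simp_all add: a_def algebra_simps\<close>)
  qed
  then show thesis by (rule that)
qed


section \<open>Non-existence below 3r - 4 points and existence at 3r - 4 points\<close>

lemma not_AE_False_PiM_lborel:
  assumes "finite I"
  shows "\<not> (AE x in Pi\<^sub>M I (\<lambda>_. lborel :: 'a::euclidean_space measure). False)"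
proof -
  interpret product_sigma_finite "\<lambda>_. lborel :: 'a measure" ..
  have "emeasure (Pi\<^sub>M I (\<lambda>_. lborel :: 'a measure)) (space (Pi\<^sub>M I (\<lambda>_. lborel :: 'a measure))) \<noteq> 0"
    using assms by (auto simp: space_PiM emeasure_PiM)
  then show ?thesis
    by (simp add: AE_iff_null null_sets_def)
qed

text \<open>All polygons together form a family of dimension four, so the dimension count applies
  with \<open>V = UNIV\<close>. A partition yields a transversal once its parts are labelled by
  vertices and pulled back to sets of indices.\<close>

theorem AE_no_polygon_partition:
  assumes "N + 4 < 3 * r"
  shows "AE x in Pi\<^sub>M {..<N} (\<lambda>_. lborel). \<not> (\<exists>P. polygon_partition r (x ` {..<N}) P)"
proof -
  have "r > 0" using assms by simp
  have "AE x in Pi\<^sub>M {..<N} (\<lambda>_. lborel). \<forall>A v. disjoint_family_on A {..<r} \<longrightarrow> (\<Union>k<r. A k) \<subseteq> {..<N} \<longrightarrow>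
    v \<in> UNIV \<longrightarrow> (\<exists>k<r. vertex r k v \<notin> convex hull (x ` A k))"
    using assms by (intro AE_no_flat_transversal linear_vertex) auto
  then show ?thesis
  proof eventually_elim
    case (elim x)
    show ?case
    proof
      assume "\<exists>P. polygon_partition r (x ` {..<N}) P"
      then obtain P f c z where P: "partition_on (x ` {..<N}) P" and f: "\<forall>B\<in>P. f B \<in> convex hull B"
        and z: "z \<noteq> 0" and bij: "bij_betw f P ((\<lambda>k. vertex r k (c, z)) ` {..<r})"
        unfolding polygon_partition_def regular_polygon_vertices_iff by blast
      \<comment> \<open>The part that carries vertex \<open>k\<close>, and then its set of indices.
        Distinct vertices, due to \<open>z \<noteq> 0\<close>, give distinct and hence disjoint
        parts.\<close>
      define B where "B k = the_inv_into P f (vertex r k (c, z))" for k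
      define A where "A k = {i. i < N \<and> x i \<in> B k}" for k
      have B: "B k \<in> P" "f (B k) = vertex r k (c, z)" if "k < r" for k
        using bij that unfolding bij_betw_def B_def
        by (metis imageI lessThan_iff order_refl the_inv_into_into, metis imageI lessThan_iff f_the_inv_into_f)
      have "inj_on B {..<r}"
        using inj_on_vertex[OF \<open>r > 0\<close> z, of c] B(2) unfolding inj_on_def by (metis lessThan_iff)
      then have "disjoint_family_on A {..<r}"
        using partition_onD2[OF P] B(1) unfolding disjoint_family_on_def disjoint_def A_def inj_on_def
        by blast
      moreover have "x ` A k = B k" if "k < r" for k
        using partition_onD1[OF P] B(1)[OF that] by (auto simp: A_def)
      moreover have "(\<Union>k<r. A k) \<subseteq> {..<N}" by (auto simp: A_def)
      ultimately show False
        using elim f B by (metis UNIV_I)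
    qed
  qed
qed

text \<open>The polygon is degenerate if the second component of \<^term>\<open>v\<close> vanishes. The parts have equal weights
  iff consecutive ones do (\<open>r - 1\<close> real equations), and their weighted sums \<open>Y\<close> are a sequence
  \<open>a + b \<omega>\<^sup>k\<close> iff \<open>Y (m + 2) - (1 + \<omega>) Y (m + 1) + \<omega> Y m = 0\<close> (\<open>r - 2\<close> complex equations). These are
  \<open>3 r - 5 < N\<close> linear functionals, all of which vanish on the average over the \<open>r\<close> possible parts of a point.\<close>
theorem degenerate_polygon_partition_exists:
  fixes x :: "nat \<Rightarrow> real^2"
  assumes "r \<ge> 3" and N: "3 * r \<le> N + 4"
  obtains \<kappa> and v where "\<And>k. k < r \<Longrightarrow> vertex r k v \<in> convex hull (x ` {i. i < N \<and> \<kappa> i = k})"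
    "\<And>i. i < N \<Longrightarrow> \<kappa> i < (r::nat)"
proof -
  define \<omega> where "\<omega> = cis (2 * pi / real r)"
  define X where "X i = to_complex (x i)" for i
  define \<delta> :: "nat \<Rightarrow> nat \<Rightarrow> real" where "\<delta> = (\<lambda>m k. if k = m then 1 else 0)"
  \<comment> \<open>The coefficient with which a point in part \<open>k\<close> enters the
    recurrence at \<open>m\<close>. Over all parts it sums to
    \<open>1 - (1 + \<omega>) + \<omega> = 0\<close>.\<close>
  define R where "R = (\<lambda>m k. \<delta> (m + 2) k - (1 + \<omega>) * \<delta> (m + 1) k + \<omega> * \<delta> m k)"
  \<comment> \<open>Real parts and imaginary parts of the recurrences, then comparisons of
    consecutive part weights.\<close>
  define J where "J = {..<r-2} <+> {..<r-2} <+> {..<r-1}"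
  have J: "Inl m \<in> J \<longleftrightarrow> m < r - 2" "Inr (Inl m) \<in> J \<longleftrightarrow> m < r - 2" "Inr (Inr m) \<in> J \<longleftrightarrow> m < r - 1" for m
    by (auto simp: J_def)
  define w where "w i k j = (case j of Inl m \<Rightarrow> Re (R m k * X i) | Inr (Inl m) \<Rightarrow> Im (R m k * X i)
      | Inr (Inr m) \<Rightarrow> \<delta> (m + 1) k - \<delta> m k)" for i k j
  have sum_\<delta>: "(\<Sum>k<r. \<delta> m k) = 1" if "m < r" for m using that by (simp add: \<delta>_def)
  have sum_R: "(\<Sum>k<r. R m k) = 0" if "m < r - 2" for m
    using sum_\<delta>[of m] sum_\<delta>[of "m + 1"] sum_\<delta>[of "m + 2"] that
    by (simp add: R_def sum.distrib sum_subtractf flip: sum_distrib_left of_real_sum)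
  have zero: "(\<Sum>k<r. 1 / real r * w i k j) = 0" if "j \<in> J" for i j
  proof -
    have "(\<Sum>k<r. R m k * X i) = 0" if "m < r - 2" for m
      using sum_R[OF that] by (simp flip: sum_distrib_right)
    then have "(\<Sum>k<r. Re (R m k * X i)) = 0" "(\<Sum>k<r. Im (R m k * X i)) = 0" if "m < r - 2" for m
      using that by (simp_all only: zero_complex.sel flip: Re_sum Im_sum)
    moreover have "(\<Sum>k<r. \<delta> (m + 1) k - \<delta> m k) = 0" if "m < r - 1" for m
      using sum_\<delta>[of m] sum_\<delta>[of "m + 1"] that by (simp add: sum_subtractf)
    ultimately have "(\<Sum>k<r. w i k j) = 0"
      using that by (auto simp: J_def w_def)
    then show ?thesis by (simp flip: sum_distrib_left sum_divide_distrib)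
  qed
  \<comment> \<open>Each point is a colour, and \<open>w i k\<close> records the effect of putting
    point \<open>i\<close> into part \<open>k\<close>. Equal weights \<open>1 / r\<close> place the
    origin in the hull of every colour.\<close>
  have "card J < card {..<N}"
    using assms by (simp add: J_def card_Plus)
  then obtain \<kappa> \<xi> where \<kappa>: "\<kappa> \<in> {..<N} \<rightarrow> {..<r}" and \<xi>: "\<And>i. i \<in> {..<N} \<Longrightarrow> \<xi> i \<ge> 0" "(\<Sum>i<N. \<xi> i) = 1"
    and rel: "\<And>j. j \<in> J \<Longrightarrow> (\<Sum>i<N. \<xi> i * w i (\<kappa> i) j) = 0"
    using colorful_caratheodory[of "{..<N}" J "{..<r}" "\<lambda>_ _. 1 / real r" w] zero assms
    by (auto simp: J_def)
  define Y where "Y m = (\<Sum>i<N. \<xi> i * \<delta> m (\<kappa> i) * X i)" for m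
  define T where "T m = (\<Sum>i<N. \<xi> i * \<delta> m (\<kappa> i))" for m
  have Trec: "T (Suc m) = T m" if "Suc m < r" for m
    using rel[of "Inr (Inr m)"] that
    by (auto simp: J w_def T_def algebra_simps sum_subtractf)
  have T0: "T m = T 0" if "m < r" for m
    using that by (induction m) (simp_all add: Trec)
  have "(\<Sum>m<r. T m) = 1"
  proof -
    have "(\<Sum>m<r. T m) = (\<Sum>i<N. \<xi> i * (\<Sum>m<r. \<delta> m (\<kappa> i)))"
      unfolding T_def sum_distrib_left by (rule sum.swap)
    also have "\<dots> = (\<Sum>i<N. \<xi> i)"
      using \<kappa> by (intro sum.cong) (auto simp: \<delta>_def)
    finally show ?thesis using \<xi>(2) by simp
  qed
  moreover have "(\<Sum>m<r. T m) = (\<Sum>m<r. T 0)"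
    by (rule sum.cong[OF refl]) (rule T0, simp)
  ultimately have T: "T m = 1 / real r" if "m < r" for m
    using T0[OF that] assms by (simp add: field_simps)
  have Yrec: "Y (m + 2) = (1 + \<omega>) * Y (m + 1) - \<omega> * Y m" if "m + 2 < r" for m
  proof -
    have "(\<Sum>i<N. \<xi> i * (R m (\<kappa> i) * X i)) = 0"
      using rel[of "Inl m"] rel[of "Inr (Inl m)"] that
      by (simp add: complex_eq_iff J w_def)
    moreover have "(\<Sum>i<N. \<xi> i * (R m (\<kappa> i) * X i)) = Y (m + 2) - (1 + \<omega>) * Y (m + 1) + \<omega> * Y m"
      unfolding Y_def sum_distrib_left sum_subtractf[symmetric] sum.distrib[symmetric]
      by (intro sum.cong) (auto simp: R_def algebra_simps)
    ultimately show ?thesis by (simp add: algebra_simps)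
  qed
  have "\<omega> \<noteq> 1"
  proof
    assume "\<omega> = 1"
    then have "cis (2 * pi * real 1 / real r) = cis (2 * pi * real 0 / real r)" by (simp add: \<omega>_def)
    then show False
      using inj_onD[OF inj_on_cis_roots_unity, of r 1 0] assms(1) by simp
  qed
  from second_order_recurrence[where r = r, OF this Yrec]
  obtain a b where Y: "\<And>m. m < r \<Longrightarrow> Y m = a + b * \<omega> ^ m" by blast
  \<comment> \<open>Each part has total weight \<open>1 / r\<close>; the factor \<open>r\<close>
    turns its weighted sum into a convex combination.\<close>
  have "vertex r k (of_complex (r * a), of_complex (r * b)) \<in> convex hull (x ` {i. i < N \<and> \<kappa> i = k})"
    if "k < r" for k
  proof -
    let ?A = "{i. i < N \<and> \<kappa> i = k}"
    have filter: "(\<Sum>i<N. \<delta> k (\<kappa> i) *\<^sub>R g i) = (\<Sum>i\<in>?A. g i)" for g :: "nat \<Rightarrow> 'b::real_vector"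
      by (rule sum.mono_neutral_cong_right) (auto simp: \<delta>_def)
    have "(\<Sum>i\<in>?A. r * \<xi> i) = r * T k"
      unfolding T_def using filter[of \<xi>] by (simp add: mult.commute flip: sum_distrib_left)
    then have "(\<Sum>i\<in>?A. r * \<xi> i) = 1" using T[OF that] assms by simp
    then have "(\<Sum>i\<in>?A. (r * \<xi> i) *\<^sub>R x i) \<in> convex hull (x ` ?A)"
      using \<xi>(1) by (intro convex_sum) (auto intro: hull_inc)
    also have "(\<Sum>i\<in>?A. (r * \<xi> i) *\<^sub>R x i) = of_complex (r * Y k)"
    proof -
      have "to_complex (\<Sum>i\<in>?A. (r * \<xi> i) *\<^sub>R x i) = r * (\<Sum>i\<in>?A. \<xi> i * X i)"
        by (simp add: to_complex_sum to_complex_linear X_def sum_distrib_left mult.assoc)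
      also have "(\<Sum>i\<in>?A. \<xi> i * X i) = Y k"
        unfolding Y_def using filter[of "\<lambda>i. \<xi> i * X i"] by (simp add: scaleR_conv_of_real mult_ac)
      finally show ?thesis by (metis of_to_complex)
    qed
    also have "r * Y k = r * a + cis (2 * pi * real k / real r) * (r * b)"
    proof -
      have "\<omega> ^ k = cis (2 * pi * real k / real r)"
        by (simp add: \<omega>_def Complex.DeMoivre mult_ac)
      then show ?thesis using Y[OF that] by (simp add: algebra_simps)
    qed
    finally show ?thesis
      by (simp add: vertex_def of_complex_linear)
  qed
  then show thesis by (rule that) (use \<kappa> in auto)
qed

text \<open>The possibly degenerate polygon exists for every \<open>x\<close>. For almost every
  \<open>x\<close> it has \<open>z \<noteq> 0\<close>, and injectivity of \<open>x\<close> turns the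
  index classes into disjoint parts.\<close>

theorem polygon_partition_exists:
  assumes "r \<ge> 3" "3 * r = N + 4"
  shows "almost_any_points_admit_polygon_partition r N"
  unfolding almost_any_points_admit_polygon_partition_def
proof -
  \<comment> \<open>The degenerate polygons. The dimension count applies since
    \<open>2 + N = 3 * r - 2 < 3 * r\<close>.\<close>
  let ?V = "UNIV \<times> {0} :: ((real^2) \<times> (real^2)) set"
  have "subspace ?V" by (simp add: subspace_Times)
  moreover have "dim ?V = 2" by (simp add: dim_Times)
  ultimately have "AE x in Pi\<^sub>M {..<N} (\<lambda>_. lborel). \<forall>A v. disjoint_family_on A {..<r} \<longrightarrow> (\<Union>k<r. A k) \<subseteq> {..<N} \<longrightarrow>
    v \<in> ?V \<longrightarrow> (\<exists>k<r. vertex r k v \<notin> convex hull (x ` A k))"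
    using assms by (intro AE_no_flat_transversal linear_vertex) auto
  with AE_inj_on[of "{..<N}", OF finite_lessThan]
  show "AE x in Pi\<^sub>M {..<N} (\<lambda>_. lborel). \<exists>P. polygon_partition r (x ` {..<N}) P"
  proof eventually_elim
    case (elim x)
    obtain \<kappa> v where hull: "\<And>k. k < r \<Longrightarrow> vertex r k v \<in> convex hull (x ` {i. i < N \<and> \<kappa> i = k})"
      and \<kappa>: "\<And>i. i < N \<Longrightarrow> \<kappa> i < r"
      by (rule degenerate_polygon_partition_exists[of r N x]) (use assms in auto)
    obtain c z where v: "v = (c, z)" by (cases v)
    define A where "A k = {i. i < N \<and> \<kappa> i = k}" for k
    have A: "disjoint_family_on A {..<r}" "(\<Union>k<r. A k) = {..<N}"
      using \<kappa> by (auto simp: A_def disjoint_family_on_def)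
    have hull: "vertex r k (c, z) \<in> convex hull (x ` A k)" if "k < r" for k
      using hull[OF that] by (simp add: A_def v)
    have "(c, z) \<notin> ?V" using elim(2) A hull by blast
    then have "z \<noteq> 0" by auto
    let ?P = "(\<lambda>k. x ` A k) ` {..<r}"
    have disj: "x ` A k \<inter> x ` A l = {}" if "k \<noteq> l" for k l
      using elim(1) that by (auto simp: A_def inj_on_def)
    have ne: "x ` A k \<noteq> {}" if "k < r" for k using hull[OF that] by auto
    have inj: "inj_on (\<lambda>k. x ` A k) {..<r}"
      using disj ne unfolding inj_on_def by (metis Int_absorb lessThan_iff)
    define f where "f B = vertex r (the_inv_into {..<r} (\<lambda>k. x ` A k) B) (c, z)" for B
    have f: "f (x ` A k) = vertex r k (c, z)" if "k < r" for k
      using the_inv_into_f_f[OF inj] that by (simp add: f_def)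
    have "partition_on (x ` {..<N}) ?P"
    proof (rule partition_onI)
      show "\<Union>?P = x ` {..<N}" using A(2) by blast
      show "disjnt p q" if "p \<in> ?P" "q \<in> ?P" "p \<noteq> q" for p q
      proof -
        obtain k l where "p = x ` A k" "q = x ` A l" using \<open>p \<in> ?P\<close> \<open>q \<in> ?P\<close> by blast
        then show ?thesis using disj[of k l] \<open>p \<noteq> q\<close> by (auto simp only: disjnt_def)
      qed
    qed (use ne in auto)
    moreover have "card ?P = r" using card_image[OF inj] by simp
    moreover have "\<forall>B\<in>?P. f B \<in> convex hull B" using f hull by auto
    moreover have "bij_betw f ?P ((\<lambda>k. vertex r k (c, z)) ` {..<r})"
    proof -
      have "r > 0" using assms by simp
      have "inj_on (f \<circ> (\<lambda>k. x ` A k)) {..<r}"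
        using inj_on_vertex[OF \<open>r > 0\<close> \<open>z \<noteq> 0\<close>, of c] f by (simp add: inj_on_def)
      then show ?thesis
        using f by (auto simp: bij_betw_def image_image intro: inj_on_imageI)
    qed
    moreover have "regular_polygon_vertices r ((\<lambda>k. vertex r k (c, z)) ` {..<r})"
      using \<open>z \<noteq> 0\<close> by (auto simp: regular_polygon_vertices_iff)
    ultimately show ?case unfolding polygon_partition_def by blast
  qed
qed

theorem theorem1p1:
  fixes r :: nat
  assumes "r \<ge> 3"
  shows "polygon_number r = tverberg_number r 2 - 2
       \<and> tverberg_number r 2 - 2 = 3 * r - 4
       \<and> almost_any_points_admit_polygon_partition r (3 * r - 4)
       \<and> (\<forall>N. almost_any_points_admit_polygon_partition r N \<longrightarrow> 3 * r - 4 \<le> N)"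
proof -
  have T: "tverberg_number r 2 - 2 = 3 * r - 4"
    using assms by (simp add: tverberg_number_def algebra_simps)
  have upper: "almost_any_points_admit_polygon_partition r (3 * r - 4)"
    using assms by (intro polygon_partition_exists) auto
  \<comment> \<open>Existence and non-existence would both hold almost everywhere, on a space that
    is not null.\<close>
  have lower: "3 * r - 4 \<le> N" if N: "almost_any_points_admit_polygon_partition r N" for N
  proof (rule ccontr)
    assume "\<not> 3 * r - 4 \<le> N"
    then have "N + 4 < 3 * r" by simp
    from AE_no_polygon_partition[OF this] N
    have "AE x in Pi\<^sub>M {..<N} (\<lambda>_. lborel :: (real^2) measure). False"
      unfolding almost_any_points_admit_polygon_partition_def by eventually_elim simp
    then show False
      using not_AE_False_PiM_lborel[of "{..<N}"] by blast
  qed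
  have "polygon_number r = 3 * r - 4"
    unfolding polygon_number_def by (rule Least_equality) (use upper lower in auto)
  then show ?thesis using T upper lower by simp
qed

end
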